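(* Let $d\ge 2$, $L=BW_d$, and let $f\in R_d$ be a fourvolution. The set of minimal vectors of $L[1]:=L(f-1)$ is the set of all vectors $2^{-m}v_A\varepsilon_S$, where $m\ge 0$ is an integer, $A$ is an affine subspace of $\Omega$ of dimension $2m+1$, and $S\in RM(2,d)$.
   Context: Let $\Omega=\mathbb F_2^d$ (affine space); $RM(k,d)$ is the Reed–Muller code spanned (in the power set of $\Omega$ under symmetric difference) by affine subspaces of codimension at most $k$. $V=\mathbb R^\Omega$ has basis $v_i$ with $(v_i,v_j)=2^{\lfloor d/2\rfloor}\delta_{ij}$, $v_A=\sum_{i\in A}v_i$; $\varepsilon_S$ negates $v_i$ for $i\in S$ and fixes the others; $\tau_c:v_i\mapsto v_{i+c}$. $BW_d$ is the $\mathbb Z$-span of all $2^{-m}v_A\varepsilon_S$, $m\ge 0$, $A$ affine of dimension $2m$, $S\in RM(2,d)$. $R_d$ is the extraspecial group of order $2^{1+2d}$ generated by the $\varepsilon_S$ ($S\in RM(1,d)$) and the $\tau_c$ ($c\in\Omega$). A fourvolution is an isometry $f$ with $f^2=-1$. The lattice $L(f-1)=\{x(f-1):x\in L\}$ does not depend on the choice of the fourvolution $f\in R_d$. *)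

theory Defs
  imports
    "HOL-Analysis.Analysis"
    "HOL-Algebra.Bij"
    "HOL-Algebra.Generated_Groups"
    "HOL-Library.Z2"
    "HOL-Computational_Algebra.Group_Closure"
begin

instance bit :: finite
proof
  have "(UNIV :: bit set) \<subseteq> {0, 1}"
    using bit_not_zero_iff by auto
  then show "finite (UNIV :: bit set)"
    by (rule finite_subset) simp
qed

text \<open>The dimension \<open>d\<close> is \<open>CARD('d)\<close>; the space \<open>\<Omega>\<close> is \<open>bit ^ 'd\<close> and
  \<open>V\<close> is \<open>real ^ \<Omega>\<close>, written in coordinates with respect to the basis \<open>bw_basis i\<close>.\<close>

type_synonym 'd omega = "bit ^ 'd"
type_synonym 'd bw_space = "real ^ (bit ^ 'd)"

definition affine_subspace :: "nat \<Rightarrow> ('d::finite) omega set \<Rightarrow> bool" where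
  "affine_subspace k A \<longleftrightarrow> (\<exists>a W. vec.subspace W \<and> vec.dim W = k \<and> A = (+) a ` W)"

inductive_set RM :: "nat \<Rightarrow> ('d::finite) omega set set" for k :: nat where
  empty: "{} \<in> RM k"
| sym_diff: "affine_subspace n A \<Longrightarrow> CARD('d) \<le> n + k \<Longrightarrow> S \<in> RM k \<Longrightarrow> sym_diff A S \<in> RM k"

definition bw_basis :: "('d::finite) omega \<Rightarrow> 'd bw_space" where
  "bw_basis i = axis i 1"

text \<open>Since the \<open>bw_basis i\<close> are the standard coordinate vectors, the form with
  \<open>(bw_basis i, bw_basis i) = 2 ^ \<lfloor>d / 2\<rfloor>\<close> is a multiple of the standard inner product \<open>(\<bullet>)\<close>.\<close>

definition bw_form :: "('d::finite) bw_space \<Rightarrow> 'd bw_space \<Rightarrow> real" where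
  "bw_form x y = 2 ^ (CARD('d) div 2) * (x \<bullet> y)"

definition v_set :: "('d::finite) omega set \<Rightarrow> 'd bw_space" where
  "v_set A = (\<Sum>i\<in>A. bw_basis i)"

definition eps :: "('d::finite) omega set \<Rightarrow> 'd bw_space \<Rightarrow> 'd bw_space" where
  "eps S x = (\<Sum>i\<in>UNIV. (x $ i) *\<^sub>R (if i \<in> S then - bw_basis i else bw_basis i))"

definition tau :: "('d::finite) omega \<Rightarrow> 'd bw_space \<Rightarrow> 'd bw_space" where
  "tau c x = (\<Sum>i\<in>UNIV. (x $ i) *\<^sub>R bw_basis (i + c))"

text \<open>\<open>group_closure\<close> is the additive subgroup generated by a set, i.e. its integer span.\<close>

definition BW :: "('d::finite) bw_space set" where
  "BW = group_closure
     {(1 / 2 ^ m) *\<^sub>R eps S (v_set A) |m A S. affine_subspace (2 * m) A \<and> S \<in> RM 2}"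

text \<open>The group is taken inside the permutation group of \<open>V\<close>. Operators are written on the
  left here, so products are composed in the opposite order to a right action; the underlying
  set of a generated subgroup is unaffected.\<close>

definition R_group :: "(('d::finite) bw_space \<Rightarrow> 'd bw_space) set" where
  "R_group = generate (BijGroup UNIV) (eps ` RM 1 \<union> range tau)"

definition bw_isometry :: "(('d::finite) bw_space \<Rightarrow> 'd bw_space) \<Rightarrow> bool" where
  "bw_isometry f \<longleftrightarrow> linear f \<and> (\<forall>x y. bw_form (f x) (f y) = bw_form x y)"

definition fourvolution :: "(('d::finite) bw_space \<Rightarrow> 'd bw_space) \<Rightarrow> bool" where
  "fourvolution f \<longleftrightarrow> bw_isometry f \<and> (\<forall>x. f (f x) = - x)"

definition twist :: "(('d::finite) bw_space \<Rightarrow> 'd bw_space) \<Rightarrow> 'd bw_space set \<Rightarrow> 'd bw_space set" where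
  "twist f L = (\<lambda>x. f x - x) ` L"

definition minimal_vectors :: "('d::finite) bw_space set \<Rightarrow> 'd bw_space set" where
  "minimal_vectors L =
     {x \<in> L. x \<noteq> 0 \<and> (\<forall>y\<in>L. y \<noteq> 0 \<longrightarrow> bw_form x x \<le> bw_form y y)}"

end

theory Submission
  imports Defs
begin

text \<open>Normalise the \<open>v\<^sub>i\<close> to length \<open>1\<close>, and let the lattice of level \<open>p\<close> be spanned by the vectors
  \<open>2\<^sup>j v\<^sub>A \<epsilon>\<^sub>S\<close>, \<open>S \<in> RM(2,d)\<close>, of squared length at least \<open>2\<^sup>p\<close>. Then \<open>L\<close> has level \<open>0\<close>, and
  multiplication by \<open>2\<close> raises the level by \<open>2\<close>. The group \<open>R\<close> acts trivially on the quotients of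
  successive levels, whence \<open>L(f - 1)\<close> is the lattice of level \<open>1\<close>. Cutting \<open>\<Omega>\<close> by a coordinate
  hyperplane, a vector of level \<open>p\<close> becomes a pair of vectors of level \<open>p - 1\<close> that are congruent
  modulo level \<open>p\<close>. By induction its squared length is at least \<open>2\<^sup>p\<close>, and in the case of equality
  either one half vanishes or both halves are shortest vectors of level \<open>p - 1\<close>. Congruent shortest
  vectors are equal, opposite or orthogonal, and an \<open>R\<close>-orbit spans the space; so the two halves lie
  in one \<open>R\<close>-orbit and fit together to a vector of the required form.\<close>

section \<open>Affine subspaces over the field with two elements\<close>

lemma bit_vec_add_self [simp]: "(x :: bit ^ 'd) + x = 0"
  by (simp add: vec_eq_iff)

lemma bit_vec_double [simp]: "2 * x = (0 :: bit ^ 'd)"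
  unfolding mult_2 by simp

lemma bit_vec_add_cancel [simp]: "(x :: bit ^ 'd) + (x + y) = y"
  by (simp add: add.assoc[symmetric])

lemma bit_vec_add_cancel_right [simp]: "(y :: bit ^ 'd) + x + x = y"
  by (simp add: add.assoc)

lemma bit_vec_add_eq_0: "x + y = 0 \<longleftrightarrow> y = (x :: bit ^ 'd)"
  by (metis add_0_right bit_vec_add_cancel)

lemma bit_vec_diff [simp]: "(x :: bit ^ 'd) - y = x + y"
  by (simp add: vec_eq_iff)

lemma mem_translate_iff [simp]: "y \<in> (+) (a :: bit ^ 'd) ` A \<longleftrightarrow> a + y \<in> A"
  by (metis (no_types, lifting) bit_vec_add_cancel image_iff)

lemma affine_subspaceE:
  assumes "affine_subspace n A"
  obtains x where "x \<in> A"
  using assms unfolding affine_subspace_def by (auto dest: vec.subspace_0)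

text \<open>Any point of \<open>A\<close> can serve as the origin, and in characteristic 2 the
  difference of two points is their sum.\<close>

lemma affine_subspace_direction:
  assumes "affine_subspace n A" "x \<in> A"
  obtains W where "vec.subspace W" "vec.dim W = n" "\<And>y. y \<in> A \<longleftrightarrow> x + y \<in> W"
proof -
  obtain a W where W: "vec.subspace W" "vec.dim W = n" "A = (+) a ` W"
    using assms(1) unfolding affine_subspace_def by blast
  have "y \<in> A \<longleftrightarrow> x + y \<in> W" for y
  proof -
    have ax: "a + x \<in> W"
      using assms(2) W(3) by simp
    have eq: "a + y = (a + x) + (x + y)" "x + y = (a + x) + (a + y)"
      by (simp_all add: ac_simps)
    show ?thesis
      unfolding W(3) mem_translate_iff using vec.subspace_add[OF W(1) ax] eq by metis
  qed
  with W that show thesis by blast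
qed

lemma affine_subspaceI:
  assumes "vec.subspace W" "vec.dim W = n" "\<And>y. y \<in> A \<longleftrightarrow> x + y \<in> W"
  shows "affine_subspace n A"
  unfolding affine_subspace_def
proof (intro exI conjI)
  show "A = (+) x ` W"
    by (rule Set.set_eqI) (subst assms(3), simp only: mem_translate_iff)
qed (fact assms(1,2))+

lemma affine_subspace_translate:
  assumes "affine_subspace n A"
  shows "affine_subspace n ((+) c ` A)"
proof -
  obtain a W where W: "vec.subspace W" "vec.dim W = n" "A = (+) a ` W"
    using assms(1) unfolding affine_subspace_def by blast
  have "(+) c ` A = (+) (c + a) ` W"
    unfolding W(3) by (rule Set.set_eqI) (simp only: mem_translate_iff add.assoc add.left_commute)
  with W(1,2) show ?thesis
    unfolding affine_subspace_def by (intro exI conjI)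
qed

lemma affine_subspace_UNIV: "affine_subspace (CARD('d)) (UNIV :: ('d::finite) omega set)"
  by (rule affine_subspaceI[where W = UNIV and x = 0])
    (simp_all add: vec.subspace_UNIV card_cart_basis vec.dim_UNIV)

text \<open>By the dimension formula for the direction spaces, cutting with \<open>T\<close>, of
  codimension at most 1, costs at most one dimension.\<close>

lemma affine_subspace_Int:
  assumes "affine_subspace n A" "affine_subspace m T" "CARD('d) \<le> m + 1" "A \<inter> T \<noteq> {}"
  obtains k where "affine_subspace k (A \<inter> T :: ('d::finite) omega set)" "n \<le> k + 1"
proof -
  obtain x where x: "x \<in> A" "x \<in> T"
    using assms(4) by auto
  obtain W where W: "vec.subspace W" "vec.dim W = n" "\<And>y. y \<in> A \<longleftrightarrow> x + y \<in> W"
    using affine_subspace_direction[OF assms(1) x(1)] by blast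
  obtain V where V: "vec.subspace V" "vec.dim V = m" "\<And>y. y \<in> T \<longleftrightarrow> x + y \<in> V"
    using affine_subspace_direction[OF assms(2) x(2)] by blast
  have "vec.dim {x + y |x y. x \<in> W \<and> y \<in> V} \<le> CARD('d)"
    using vec.dim_subset_UNIV by (simp add: vec.dimension_def card_cart_basis)
  then have "n \<le> vec.dim (W \<inter> V) + 1"
    using vec.dim_sums_Int[OF W(1) V(1)] W V assms(3) by linarith
  moreover have "affine_subspace (vec.dim (W \<inter> V)) (A \<inter> T)"
    by (rule affine_subspaceI[where W = "W \<inter> V" and x = x])
      (use W V in \<open>auto intro: vec.subspace_inter\<close>)
  ultimately show thesis
    using that by blast
qed

lemma span_insert_bit:
  "vec.span (insert b B) = vec.span B \<union> (+) b ` vec.span (B :: (bit ^ 'd::finite) set)"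
proof -
  have ex_bit: "(\<exists>k :: bit. P k) \<longleftrightarrow> P 0 \<or> P 1" for P
    by (metis bit.exhaust)
  have "(\<exists>k. x - k *s b \<in> vec.span B) \<longleftrightarrow> x \<in> vec.span B \<or> b + x \<in> vec.span B" for x
    unfolding ex_bit by (simp add: add.commute)
  then show ?thesis
    unfolding vec.span_insert by auto
qed

text \<open>Disjointness puts \<open>c\<close> outside the direction space, so adjoining
  \<open>c\<close> raises the dimension by one.\<close>

lemma affine_subspace_Un_translate:
  assumes "affine_subspace n A" "A \<inter> (+) c ` A = {}"
  shows "affine_subspace (n + 1) (A \<union> (+) c ` (A :: ('d::finite) omega set))"
proof -
  obtain x where x: "x \<in> A"
    using affine_subspaceE[OF assms(1)] .
  obtain W where W: "vec.subspace W" "vec.dim W = n" "\<And>y. y \<in> A \<longleftrightarrow> x + y \<in> W"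
    using affine_subspace_direction[OF assms(1) x(1)] by blast
  have sp: "vec.span W = W"
    using W(1) by (rule vec.span_eq_iff[THEN iffD2])
  have "c + x \<notin> A"
    using assms(2) x by (metis IntI bit_vec_add_cancel emptyE imageI)
  then have "c \<notin> vec.span W"
    unfolding sp using W(3)[of "c + x"] by (simp add: add.left_commute)
  then have d: "vec.dim (vec.span (insert c W)) = n + 1"
    using vec.dim_insert[of c W] W(2) by simp
  show ?thesis
  proof (rule affine_subspaceI[where x = x, OF _ d])
    show "y \<in> A \<union> (+) c ` A \<longleftrightarrow> x + y \<in> vec.span (insert c W)" for y
      unfolding span_insert_bit sp Un_iff mem_translate_iff W(3) by (simp add: add.left_commute)
  qed simp
qed

lemma translate_eq_or_disjoint:
  assumes "affine_subspace n (A :: ('d::finite) omega set)"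
  shows "(+) c ` A = A \<or> A \<inter> (+) c ` A = {}"
proof -
  obtain x where x: "x \<in> A"
    using affine_subspaceE[OF assms(1)] .
  obtain W where W: "vec.subspace W" "vec.dim W = n" "\<And>y. y \<in> A \<longleftrightarrow> x + y \<in> W"
    using affine_subspace_direction[OF assms(1) x(1)] by blast
  have c: "x + (c + y) = c + (x + y)" for y
    by (simp add: ac_simps)
  show ?thesis
  proof (cases "c \<in> W")
    case True
    then have "c + w \<in> W \<longleftrightarrow> w \<in> W" for w
      using vec.subspace_add[OF W(1) True] by (metis bit_vec_add_cancel)
    then have "c + y \<in> A \<longleftrightarrow> y \<in> A" for y
      unfolding W(3) c by blast
    then show ?thesis
      by auto
  next
    case False
    then have "w \<in> W \<Longrightarrow> c + w \<notin> W" for w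
      using vec.subspace_add[OF W(1)] by (metis bit_vec_add_cancel_right)
    then have "y \<in> A \<Longrightarrow> c + y \<notin> A" for y
      unfolding W(3) c by blast
    then show ?thesis
      by auto
  qed
qed

lemma card_span_bit:
  assumes "finite B" "vec.independent (B :: (bit ^ 'd::finite) set)"
  shows "card (vec.span B) = 2 ^ card B"
  using assms
proof (induction B)
  case (insert b B)
  then have ind: "vec.independent B" and b: "b \<notin> vec.span B"
    by (auto simp: vec.independent_insert)
  have "vec.span B \<inter> (+) b ` vec.span B = {}"
    using b vec.span_add by (metis disjoint_iff mem_translate_iff bit_vec_add_cancel_right)
  moreover have "card ((+) b ` vec.span B) = card (vec.span B)"
    by (intro card_image) (auto simp: inj_on_def)
  ultimately show ?case
    using insert ind by (simp add: span_insert_bit card_Un_disjoint)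
qed simp

lemma card_affine_subspace:
  assumes "affine_subspace n (A :: ('d::finite) omega set)"
  shows "card A = 2 ^ n"
proof -
  obtain a W where W: "vec.subspace W" "vec.dim W = n" "A = (+) a ` W"
    using assms(1) unfolding affine_subspace_def by blast
  obtain B where B: "B \<subseteq> W" "vec.independent B" "W \<subseteq> vec.span B" "card B = vec.dim W"
    using vec.basis_exists by blast
  have "vec.span B = W"
    using B W(1) by (simp add: vec.span_subspace)
  moreover have "card A = card W"
    unfolding W(3) by (intro card_image) (auto simp: inj_on_def)
  ultimately show ?thesis
    using card_span_bit[of B] B W by simp
qed

lemma affine_subspace_dim_unique:
  assumes "affine_subspace n (A :: ('d::finite) omega set)" "affine_subspace m A"
  shows "n = m"
  using card_affine_subspace[OF assms(1)] card_affine_subspace[OF assms(2)] by simp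

text \<open>The codimension is \<open>1\<close> because the hyperplane and its translate by a unit vector partition \<open>\<Omega>\<close>.\<close>

lemma affine_subspace_coordinate:
  obtains m where "affine_subspace m {x :: ('d::finite) omega. x $ k = b}" "CARD('d) \<le> m + 1"
proof -
  let ?W = "{x :: 'd omega. x $ k = 0}"
  have W: "vec.subspace ?W"
    by (auto simp: vec.subspace_def)
  have aff: "affine_subspace (vec.dim ?W) {x :: ('d::finite) omega. x $ k = c}" for c
    by (rule affine_subspaceI[OF W refl, where x = "axis k c"]) (cases c; auto simp: axis_def)
  have "{x :: 'd omega. x $ k = 0} \<inter> (+) (axis k 1) ` {x. x $ k = 0} = {}"
    by (auto simp: axis_def)
  then have "affine_subspace (vec.dim ?W + 1) (?W \<union> (+) (axis k 1) ` ?W)"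
    by (rule affine_subspace_Un_translate[OF aff])
  moreover have "?W \<union> (+) (axis k 1) ` ?W = UNIV"
    by (auto simp: axis_def)
  ultimately have "CARD('d) = vec.dim ?W + 1"
    using affine_subspace_dim_unique affine_subspace_UNIV by metis
  then show thesis
    using that[OF aff] by simp
qed

text \<open>The vector \<open>p + q\<close> lies in the direction space and has coordinate 1 at
  \<open>k\<close>, so translation by it exchanges the two halves of \<open>A\<close>.\<close>

lemma affine_subspace_split:
  assumes "affine_subspace n A" "p \<in> A" "q \<in> A" "p $ k = 0" "q $ k = 1"
  defines "A0 \<equiv> A \<inter> {x :: ('d::finite) omega. x $ k = 0}"
  obtains n' a where "affine_subspace n' A0" "n = n' + 1" "a $ k = 1"
    "A \<inter> {x. x $ k = 1} = (+) a ` A0" "A0 \<inter> (+) a ` A0 = {}"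
    "a = p + q" "A = A0 \<union> (+) a ` A0"
proof -
  obtain m where m: "affine_subspace m {x :: 'd omega. x $ k = 0}" "CARD('d) \<le> m + 1"
    using affine_subspace_coordinate .
  have "A \<inter> {x. x $ k = 0} \<noteq> {}"
    using assms(2,4) by blast
  then obtain n' where n': "affine_subspace n' A0"
    unfolding A0_def using affine_subspace_Int[OF assms(1) m] by metis
  obtain W where W: "vec.subspace W" "vec.dim W = n" "\<And>y. y \<in> A \<longleftrightarrow> p + y \<in> W"
    using affine_subspace_direction[OF assms(1,2)] by blast
  let ?a = "p + q"
  have "?a \<in> W"
    using W(3) assms(3) by blast
  then have "(p + q) + y \<in> A \<longleftrightarrow> y \<in> A" for y
    unfolding W(3) using vec.subspace_add[OF W(1) \<open>?a \<in> W\<close>]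
    by (metis add.left_commute bit_vec_add_cancel)
  then have eq: "A \<inter> {x. x $ k = 1} = (+) ?a ` A0"
    using assms(4,5) by (auto simp: A0_def)
  moreover have "A0 \<inter> {x. x $ k = 1} = {}"
    by (auto simp: A0_def)
  ultimately have disj: "A0 \<inter> (+) ?a ` A0 = {}"
    by blast
  have un: "A = A0 \<union> (+) ?a ` A0"
    unfolding eq[symmetric] by (auto simp: A0_def)
  have "n = n' + 1"
    by (rule affine_subspace_dim_unique[OF assms(1)])
      (subst un, rule affine_subspace_Un_translate[OF n' disj])
  then show thesis
    by (rule that[OF n' _ _ eq disj refl un]) (simp_all add: assms(4,5))
qed

lemma affine_subspace_0_singleton: "affine_subspace 0 {x :: ('d::finite) omega}"
  by (rule affine_subspaceI[where W = "{0}" and x = x])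
    (simp_all add: vec.subspace_def bit_vec_add_eq_0)

section \<open>Reed-Muller codes\<close>

lemma sym_diff_translate: "(+) c ` sym_diff A B = sym_diff ((+) c ` A) ((+) (c :: bit ^ 'd) ` B)"
  by (rule Set.set_eqI) (simp only: mem_translate_iff Un_iff Diff_iff)

lemma RM_affine_subspace:
  assumes "affine_subspace n (A :: ('d::finite) omega set)" "CARD('d) \<le> n + k"
  shows "A \<in> RM k"
  using RM.sym_diff[OF assms RM.empty] by simp

lemma RM_sym_diff:
  assumes "S \<in> RM k" "T \<in> RM k"
  shows "sym_diff S T \<in> RM k"
  using assms(1)
proof induction
  case (sym_diff n A S)
  have "sym_diff (sym_diff A S) T = sym_diff A (sym_diff S T)"
    by blast
  then show ?case
    using RM.sym_diff[OF sym_diff(1,2,4)] by simp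
qed (use assms(2) in simp)

lemma RM_UNIV: "UNIV \<in> RM k"
  by (rule RM_affine_subspace[OF affine_subspace_UNIV]) simp

lemma RM_coordinate: "{x :: ('d::finite) omega. x $ k = b} \<in> RM 1"
  using affine_subspace_coordinate RM_affine_subspace by metis

lemma RM_translate:
  assumes "S \<in> RM k"
  shows "(+) c ` S \<in> RM k"
  using assms
proof induction
  case (sym_diff n A S)
  then show ?case
    unfolding sym_diff_translate using RM.sym_diff affine_subspace_translate by metis
qed (simp add: RM.empty)

text \<open>The derivative in direction \<open>c\<close> lowers the degree: a generator is either
  fixed by the translation and contributes nothing, or disjoint from its translate, and then the
  union has one more dimension.\<close>

lemma RM_sym_diff_translate:
  assumes "S \<in> RM (k + 1)"
  shows "sym_diff S ((+) c ` S) \<in> RM k"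
  using assms
proof induction
  case (sym_diff n A S)
  have "sym_diff A ((+) c ` A) \<in> RM k"
  proof (cases "(+) c ` A = A")
    case True
    then show ?thesis
      by (simp add: RM.empty)
  next
    case False
    then have disj: "A \<inter> (+) c ` A = {}"
      using translate_eq_or_disjoint[OF sym_diff(1)] by blast
    then have "sym_diff A ((+) c ` A) = A \<union> (+) c ` A"
      by blast
    then show ?thesis
      using RM_affine_subspace[OF affine_subspace_Un_translate[OF sym_diff(1) disj]] sym_diff(2)
      by simp
  qed
  from RM_sym_diff[OF this sym_diff(4)]
  show ?case
    unfolding sym_diff_translate by (rule back_subst[where P = "\<lambda>X. X \<in> RM k"]) blast
qed (simp add: RM.empty)

text \<open>In terms of polynomials, multiplication by a function of degree at most 1 raises the
  degree by at most one.\<close>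

lemma RM_Int:
  assumes "S \<in> RM k" "affine_subspace m (T :: ('d::finite) omega set)" "CARD('d) \<le> m + 1"
  shows "S \<inter> T \<in> RM (k + 1)"
  using assms(1)
proof induction
  case (sym_diff n A S)
  have "A \<inter> T \<in> RM (k + 1)"
  proof (cases "A \<inter> T = {}")
    case False
    then obtain l where "affine_subspace l (A \<inter> T)" "n \<le> l + 1"
      using affine_subspace_Int[OF sym_diff(1) assms(2,3)] by blast
    then show ?thesis
      using RM_affine_subspace sym_diff(2) by fastforce
  qed (simp add: RM.empty)
  from RM_sym_diff[OF this sym_diff(4)]
  show ?case
    by (rule back_subst[where P = "\<lambda>X. X \<in> RM (k + 1)"]) blast
qed (simp add: RM.empty)

section \<open>The level filtration\<close>

lemma sum_axis_nth: "(\<Sum>i\<in>UNIV. f i *\<^sub>R axis i (1 :: real)) $ k = f (k :: 'n::finite)"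
proof -
  have "(\<Sum>i\<in>UNIV. f i *\<^sub>R axis i (1 :: real)) $ k = (\<Sum>i\<in>UNIV. if k = i then f i else 0)"
    unfolding sum_component by (rule sum.cong) (auto simp: axis_def)
  then show ?thesis
    by simp
qed

lemma v_set_nth: "v_set A $ k = of_bool (k \<in> A)"
proof -
  have "v_set A $ k = (\<Sum>i\<in>A. if k = i then 1 else 0)"
    unfolding v_set_def sum_component bw_basis_def by (rule sum.cong) (auto simp: axis_def)
  then show ?thesis
    by simp
qed

lemma eps_nth: "eps S x $ k = (if k \<in> S then - x $ k else x $ k)"
proof -
  have "eps S x = (\<Sum>i\<in>UNIV. (if i \<in> S then - x $ i else x $ i) *\<^sub>R axis i 1)"
    unfolding eps_def bw_basis_def by (rule sum.cong) auto
  then show ?thesis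
    using sum_axis_nth[of "\<lambda>i. if i \<in> S then - x $ i else x $ i" k] by simp
qed

lemma tau_nth: "tau c x $ k = x $ (c + k)"
proof -
  have "tau c x = (\<Sum>i\<in>UNIV. (x $ (c + i)) *\<^sub>R axis i 1)"
    unfolding tau_def bw_basis_def
    by (rule sum.reindex_bij_witness[where i = "(+) c" and j = "(+) c"]) (simp_all add: add.commute)
  then show ?thesis
    using sum_axis_nth[of "\<lambda>i. x $ (c + i)" k] by simp
qed

lemma eps_diff: "eps S (x - y) = eps S x - eps S y"
  by (simp add: vec_eq_iff eps_nth)

lemma tau_diff: "tau c (x - y) = tau c x - tau c y"
  by (simp add: vec_eq_iff tau_nth)

lemma tau_0 [simp]: "tau c 0 = 0"
  by (simp add: vec_eq_iff tau_nth)

lemma eps_empty [simp]: "eps {} x = x"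
  by (simp add: vec_eq_iff eps_nth)

lemma eps_UNIV [simp]: "eps UNIV x = - x"
  by (simp add: vec_eq_iff eps_nth)

lemma eps_eps: "eps S (eps T x) = eps (sym_diff S T) x"
  by (simp add: vec_eq_iff eps_nth)

lemma tau_tau [simp]: "tau c (tau c x) = x"
  by (simp add: vec_eq_iff tau_nth)

lemma eps_eps_self [simp]: "eps S (eps S x) = x"
  by (simp add: vec_eq_iff eps_nth)

lemma inner_eps: "eps S x \<bullet> eps S y = x \<bullet> y"
  unfolding inner_vec_def by (rule sum.cong) (auto simp: eps_nth)

lemma inner_tau: "tau c x \<bullet> tau c y = x \<bullet> y"
  unfolding inner_vec_def
  by (rule sum.reindex_bij_witness[where i = "(+) c" and j = "(+) c"]) (simp_all add: tau_nth)

text \<open>The exponent is an arbitrary integer, so that multiplication and division by 2 both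
  preserve the family of these vectors.\<close>

definition gvec :: "int \<Rightarrow> ('d::finite) omega set \<Rightarrow> 'd omega set \<Rightarrow> 'd bw_space" where
  "gvec j A S = 2 powi j *\<^sub>R eps S (v_set A)"

lemma gvec_nth:
  "gvec j A S $ i = (if i \<in> A then if i \<in> S then - (2 powi j) else 2 powi j else 0)"
  by (simp add: gvec_def eps_nth v_set_nth)

lemma gvec_empty [simp]: "gvec j {} S = 0"
  by (simp add: vec_eq_iff gvec_nth)

lemma tau_gvec: "tau c (gvec j A S) = gvec j ((+) c ` A) ((+) c ` S)"
  unfolding vec_eq_iff tau_nth gvec_nth mem_translate_iff by simp

lemma eps_gvec: "eps T (gvec j A S) = gvec j A (sym_diff S T)"
  by (simp add: vec_eq_iff eps_nth gvec_nth)

lemma double_gvec: "2 *\<^sub>R gvec j A S = gvec (j + 1) A S"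
  by (simp add: vec_eq_iff gvec_nth power_int_add)

lemma gvec_Un:
  assumes "A \<inter> B = {}"
  shows "gvec j (A \<union> B) S = gvec j A S + gvec j B S"
  using assms by (auto simp: vec_eq_iff gvec_nth)

lemma gvec_cong:
  assumes "A \<inter> S = A \<inter> T"
  shows "gvec j A S = gvec j A T"
  using assms by (auto simp: vec_eq_iff gvec_nth set_eq_iff)

lemma inner_gvec:
  assumes "affine_subspace n A"
  shows "gvec j A S \<bullet> gvec j A S = 2 powi (2 * j + int n)"
proof -
  have "gvec j A S \<bullet> gvec j A S = (\<Sum>i\<in>UNIV. if i \<in> A then 2 powi j * 2 powi j else 0)"
    unfolding inner_vec_def by (rule sum.cong) (auto simp: gvec_nth)
  also have "\<dots> = 2 ^ n * (2 powi j * 2 powi j)"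
    using card_affine_subspace[OF assms] by (simp add: sum.If_cases)
  also have "\<dots> = 2 powi (2 * j + int n)"
    unfolding mult_2 by (subst power_int_add, simp, subst power_int_add, simp_all)
  finally show ?thesis .
qed

text \<open>A generator \<open>gvec j A S\<close> has squared length \<open>2 powi (2 * j + dim A)\<close>, and
  the lattice of level \<open>p\<close> is spanned by the generators of squared length at least \<open>2 powi p\<close>.
  The set \<open>U\<close> restricts the support, so that the lattices of lower rank needed for the induction
  live in the same space.\<close>

definition gens :: "int \<Rightarrow> ('d::finite) omega set \<Rightarrow> 'd bw_space set" where
  "gens p U = {gvec j A S |j A S n. affine_subspace n A \<and> A \<subseteq> U \<and> S \<in> RM 2 \<and> p \<le> 2 * j + int n}"

definition lat :: "int \<Rightarrow> ('d::finite) omega set \<Rightarrow> 'd bw_space set" where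
  "lat p U = group_closure (gens p U)"

text \<open>The candidates for the minimal vectors of \<open>lat p U\<close>; \<open>lat_min\<close>
  confirms them when \<open>U\<close> is a coordinate subspace.\<close>

definition shortest :: "int \<Rightarrow> ('d::finite) omega set \<Rightarrow> 'd bw_space set" where
  "shortest p U = {gvec j A S |j A S n. affine_subspace n A \<and> A \<subseteq> U \<and> S \<in> RM 2 \<and> 2 * j + int n = p}"

lemma gvec_in_lat:
  assumes "affine_subspace n A" "A \<subseteq> U" "S \<in> RM 2" "p \<le> 2 * j + int n"
  shows "gvec j A S \<in> lat p U"
  unfolding lat_def gens_def using assms by (intro group_closure.base) blast

lemma lat_0 [simp]: "0 \<in> lat p U"
  by (simp add: lat_def)

lemma lat_diff: "x \<in> lat p U \<Longrightarrow> y \<in> lat p U \<Longrightarrow> x - y \<in> lat p U"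
  unfolding lat_def by (rule group_closure.diff)

lemma lat_add: "x \<in> lat p U \<Longrightarrow> y \<in> lat p U \<Longrightarrow> x + y \<in> lat p U"
  unfolding lat_def by (rule group_closure_add)

lemma lat_uminus_iff [simp]: "- x \<in> lat p U \<longleftrightarrow> x \<in> lat p U"
  by (simp add: lat_def)

lemma group_closure_map:
  fixes g :: "'a::ab_group_add \<Rightarrow> 'b::ab_group_add"
  assumes "x \<in> group_closure X" "\<And>x y. g (x - y) = g x - g y"
    and "\<And>x. x \<in> X \<Longrightarrow> g x \<in> group_closure Y"
  shows "g x \<in> group_closure Y"
  using assms(1)
proof induction
  case (base s)
  \<comment> \<open>The rule \<open>base\<close> of \<open>group_closure\<close> also covers the
    zero element.\<close>
  have "g 0 = 0"
    using assms(2)[of 0 0] by simp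
  then show ?case
    using base assms(3) by auto
qed (simp add: assms(2) group_closure.diff)

lemma lat_map:
  fixes g :: "('d::finite) bw_space \<Rightarrow> 'd bw_space"
  assumes "x \<in> lat p U" "\<And>x y. g (x - y) = g x - g y"
    and "\<And>j A S n. \<lbrakk>affine_subspace n A; A \<subseteq> U; S \<in> RM 2; p \<le> 2 * j + int n\<rbrakk>
      \<Longrightarrow> g (gvec j A S) \<in> lat q V"
  shows "g x \<in> lat q V"
  unfolding lat_def
  by (rule group_closure_map[OF assms(1)[unfolded lat_def] assms(2)])
    (use assms(3) in \<open>auto simp: gens_def lat_def\<close>)

lemma lat_mono:
  fixes x :: "('d::finite) bw_space"
  assumes "x \<in> lat q U" "p \<le> q" "U \<subseteq> V"
  shows "x \<in> lat p V"
proof (rule lat_map[where g = "\<lambda>x. x", OF assms(1)])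
  fix j n and A S :: "'d omega set"
  assume "affine_subspace n A" "A \<subseteq> U" "S \<in> RM 2" "q \<le> 2 * j + int n"
  then show "gvec j A S \<in> lat p V"
    using assms(2,3) by (intro gvec_in_lat) auto
qed simp

lemma double_in_lat:
  assumes "x \<in> lat p U"
  shows "2 *\<^sub>R x \<in> lat (p + 2) U"
  by (rule lat_map[OF assms]) (simp_all add: double_gvec scaleR_diff_right gvec_in_lat)

lemma half_in_lat:
  fixes x :: "('d::finite) bw_space"
  assumes "x \<in> lat (p + 2) U"
  shows "(1 / 2) *\<^sub>R x \<in> lat p U"
proof (rule lat_map[OF assms])
  fix j n and A S :: "'d omega set"
  assume *: "affine_subspace n A" "A \<subseteq> U" "S \<in> RM 2" "p + 2 \<le> 2 * j + int n"
  have "(1 / 2) *\<^sub>R gvec j A S = gvec (j - 1) A S"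
    by (simp add: vec_eq_iff gvec_nth power_int_diff)
  then show "(1 / 2) *\<^sub>R gvec j A S \<in> lat p U"
    using * by (auto intro: gvec_in_lat)
qed (simp add: scaleR_diff_right)

lemma shortest_subset_lat: "shortest p U \<subseteq> lat p U"
  unfolding shortest_def by (auto intro: gvec_in_lat)

lemma inner_shortest:
  assumes "x \<in> shortest p U"
  shows "x \<bullet> x = 2 powi p"
  using assms unfolding shortest_def by (auto simp: inner_gvec)

section \<open>Action of the extraspecial group on the levels\<close>

text \<open>Negating a generator on \<open>B\<close> subtracts twice its part in \<open>B\<close>:
  doubling raises the level by 2, and the cut with \<open>B\<close>, of codimension at most 1, costs
  at most 1. Products of such sign changes follow by induction.\<close>

lemma eps_in_lat:
  fixes x :: "('d::finite) bw_space"
  assumes "x \<in> lat p U" "T \<in> RM 1"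
  shows "eps T x - x \<in> lat (p + 1) U"
  using assms(2)
proof induction
  case (sym_diff m B T)
  have step: "eps B y - y \<in> lat (p + 1) U" if "y \<in> lat p U" for y
  proof (rule lat_map[OF that])
    fix j n and A S :: "'d omega set"
    assume *: "affine_subspace n A" "A \<subseteq> U" "S \<in> RM 2" "p \<le> 2 * j + int n"
    have eq: "eps B (gvec j A S) - gvec j A S = - gvec (j + 1) (A \<inter> B) S"
      unfolding double_gvec[symmetric] by (simp add: vec_eq_iff eps_nth gvec_nth)
    show "eps B (gvec j A S) - gvec j A S \<in> lat (p + 1) U"
    proof (cases "A \<inter> B = {}")
      case False
      then obtain k where "affine_subspace k (A \<inter> B)" "n \<le> k + 1"
        using affine_subspace_Int[OF *(1) sym_diff(1,2)] by blast
      then show ?thesis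
        unfolding eq lat_uminus_iff using * by (intro gvec_in_lat) auto
    qed (simp add: eq)
  qed (simp add: eps_diff)
  have "eps T x \<in> lat p U"
    using lat_add[OF lat_mono[OF sym_diff(4), of p U] assms(1)] by simp
  from lat_add[OF step[OF this] sym_diff(4)] show ?case
    by (simp add: eps_eps)
qed simp

text \<open>Two moves suffice on a generator. Replacing \<open>S\<close> by its translate is a sign
  change from \<open>RM 1\<close>. Moving \<open>A\<close> to a disjoint translate adds the
  generator on the union and subtracts twice the generator on \<open>A\<close>, both of level
  \<open>p + 1\<close>.\<close>

lemma tau_in_lat:
  fixes x :: "('d::finite) bw_space"
  assumes "x \<in> lat p U" "(+) c ` U = U"
  shows "tau c x - x \<in> lat (p + 1) U"
proof (rule lat_map[OF assms(1)])
  fix j n and A S :: "'d omega set"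
  assume *: "affine_subspace n A" "A \<subseteq> U" "S \<in> RM 2" "p \<le> 2 * j + int n"
  have cA: "(+) c ` A \<subseteq> U"
    using *(2) assms(2) by blast
  let ?g = "gvec j ((+) c ` A) S"
  have "?g \<in> lat p U"
    using affine_subspace_translate[OF *(1)] cA * by (intro gvec_in_lat)
  moreover have "sym_diff S ((+) c ` S) \<in> RM 1"
    using RM_sym_diff_translate[of S 1 c, unfolded one_add_one, OF *(3)] .
  ultimately have "eps (sym_diff S ((+) c ` S)) ?g - ?g \<in> lat (p + 1) U"
    by (rule eps_in_lat)
  moreover have "eps (sym_diff S ((+) c ` S)) ?g = tau c (gvec j A S)"
    unfolding tau_gvec eps_gvec by (rule arg_cong[where f = "gvec j ((+) c ` A)"]) blast
  ultimately have 1: "tau c (gvec j A S) - ?g \<in> lat (p + 1) U"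
    by simp
  have 2: "?g - gvec j A S \<in> lat (p + 1) U"
  proof (cases "(+) c ` A = A")
    case False
    then have disj: "A \<inter> (+) c ` A = {}"
      using translate_eq_or_disjoint[OF *(1)] by blast
    have "gvec j (A \<union> (+) c ` A) S \<in> lat (p + 1) U"
      using affine_subspace_Un_translate[OF *(1) disj] * cA by (intro gvec_in_lat) auto
    moreover have "gvec (j + 1) A S \<in> lat (p + 1) U"
      using * by (intro gvec_in_lat) auto
    ultimately have "gvec j (A \<union> (+) c ` A) S - gvec (j + 1) A S \<in> lat (p + 1) U"
      by (rule lat_diff)
    then show ?thesis
      unfolding gvec_Un[OF disj] double_gvec[symmetric] by (simp add: scaleR_2)
  qed simp
  show "tau c (gvec j A S) - gvec j A S \<in> lat (p + 1) U"
    using lat_add[OF 1 2] by simp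
qed (simp add: tau_diff)

lemma eps_tau_in_lat:
  assumes "x \<in> lat p U" "(+) c ` U = U" "T \<in> RM 1"
  shows "eps T (tau c x) - x \<in> lat (p + 1) U"
proof -
  have t: "tau c x - x \<in> lat (p + 1) U"
    using tau_in_lat assms by blast
  then have "tau c x \<in> lat p U"
    using lat_add[OF lat_mono[OF t, of p U] assms(1)] by simp
  from lat_add[OF eps_in_lat[OF this assms(3)] t] show ?thesis
    by simp
qed

section \<open>Halves of a vector along a coordinate hyperplane\<close>

definition restr :: "('d::finite) omega set \<Rightarrow> 'd bw_space \<Rightarrow> 'd bw_space" where
  "restr B x = (\<chi> i. if i \<in> B then x $ i else 0)"

lemma restr_nth: "restr B x $ i = (if i \<in> B then x $ i else 0)"
  by (simp add: restr_def)

lemma restr_diff: "restr B (x - y) = restr B x - restr B y"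
  by (simp add: vec_eq_iff restr_nth)

lemma restr_gvec: "restr B (gvec j A S) = gvec j (A \<inter> B) S"
  by (simp add: vec_eq_iff restr_nth gvec_nth)

definition coord_space :: "'d set \<Rightarrow> ('d::finite) omega set" where
  "coord_space J = {x. \<forall>k. k \<notin> J \<longrightarrow> x $ k = 0}"

lemma coord_space_add: "x \<in> coord_space J \<Longrightarrow> y \<in> coord_space J \<Longrightarrow> x + y \<in> coord_space J"
  by (simp add: coord_space_def)

lemma coord_space_translate:
  assumes "c \<in> coord_space J"
  shows "(+) c ` coord_space J = coord_space J"
  by (rule Set.set_eqI) (metis assms bit_vec_add_cancel coord_space_add mem_translate_iff)

text \<open>Here \<open>y\<close> is the upper half shifted down into \<open>coord_space J\<close>.
  A generator supported in one half leaves a single nonzero part, still of level \<open>p\<close>.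
  If its support meets both halves, each part loses one dimension, hence has level
  \<open>p - 1\<close>, and an element of R carries one part to the other.\<close>

lemma restr_in_lat:
  fixes J :: "('d::finite) set"
  assumes "x \<in> lat p (coord_space (insert k J))" "k \<notin> J"
  defines "x0 \<equiv> restr {i. i $ k = 0} x" and "y \<equiv> tau (axis k 1) (restr {i. i $ k = 1} x)"
  shows "x0 - y \<in> lat p (coord_space J)" "x0 \<in> lat (p - 1) (coord_space J)"
    "y \<in> lat (p - 1) (coord_space J)"
proof -
  let ?e = "axis k 1 :: 'd omega"
  have e0: "?e \<in> coord_space (insert k J)"
    by (simp add: coord_space_def axis_def)
  have low: "x \<in> coord_space J" if "x \<in> coord_space (insert k J)" "x $ k = 0" for x
    using that by (auto simp: coord_space_def)
  have A0: "A \<inter> {i. i $ k = 0} \<subseteq> coord_space J" if "A \<subseteq> coord_space (insert k J)" for A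
    using that low by blast
  have A1: "?e + i \<in> coord_space J" if "i \<in> coord_space (insert k J)" "i $ k = 1" for i
    by (rule low[OF coord_space_add[OF e0 that(1)]]) (simp add: that)
  have main: "gvec j (A \<inter> {i. i $ k = 0}) S - tau ?e (gvec j (A \<inter> {i. i $ k = 1}) S) \<in> lat p (coord_space J)
      \<and> gvec j (A \<inter> {i. i $ k = 0}) S \<in> lat (p - 1) (coord_space J)"
    if *: "affine_subspace n A" "A \<subseteq> coord_space (insert k J)" "S \<in> RM 2" "p \<le> 2 * j + int n"
    for j A S n
  proof -
    consider "A \<subseteq> {i. i $ k = 0}" | "A \<subseteq> {i. i $ k = 1}"
      | q r where "q \<in> A" "r \<in> A" "q $ k = 0" "r $ k = 1"
      using bit_not_zero_iff by blast
    then show ?thesis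
    proof cases
      case 1
      then have "A \<inter> {i. i $ k = 0} = A" "A \<inter> {i. i $ k = 1} = {}"
        by auto
      then show ?thesis
        using * A0[OF *(2)] by (simp add: gvec_in_lat)
    next
      case 2
      then have "A \<inter> {i. i $ k = 1} = A" "A \<inter> {i. i $ k = 0} = {}"
        by auto
      moreover have "gvec j ((+) ?e ` A) ((+) ?e ` S) \<in> lat p (coord_space J)"
        using affine_subspace_translate[OF *(1)] 2 A1 * RM_translate[OF *(3)]
        by (intro gvec_in_lat) auto
      ultimately show ?thesis
        by (simp add: tau_gvec)
    next
      case 3
      define A' where "A' = A \<inter> {i. i $ k = 0}"
      obtain n' a where n': "affine_subspace n' A'" "n = n' + 1"
        and a: "A \<inter> {x. x $ k = 1} = (+) a ` A'" "a = q + r"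
        by (rule affine_subspace_split[OF *(1) 3, folded A'_def]) (rule that)
      \<comment> \<open>Shifting the upper half down turns \<open>a\<close> into \<open>c\<close>,
        whose coordinate at \<open>k\<close> is 0, so \<open>c\<close> lies in
        \<open>coord_space J\<close>.\<close>
      define c where "c = ?e + a"
      have "a \<in> coord_space (insert k J)"
        unfolding a(2) using 3 *(2) by (intro coord_space_add) auto
      then have c: "c \<in> coord_space J"
        unfolding c_def by (rule A1) (simp add: 3 a(2))
      have g: "gvec j A' S \<in> lat (p - 1) (coord_space J)"
        using n' * A0[OF *(2)] by (intro gvec_in_lat) (auto simp: A'_def)
      \<comment> \<open>Chosen to turn the signs translated by \<open>c\<close> into those
        translated by \<open>?e\<close>; each part is a derivative of \<open>S\<close>, hence in
        \<open>RM 1\<close>.\<close>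
      define T where "T = sym_diff (sym_diff S ((+) c ` S)) (sym_diff S ((+) ?e ` S))"
      have T: "T \<in> RM 1"
        unfolding T_def
        by (intro RM_sym_diff RM_sym_diff_translate[of S 1, unfolded one_add_one, OF *(3)])
      have "(+) ?e ` (+) a ` A' = (+) c ` A'"
        unfolding c_def by (rule Set.set_eqI) (simp only: mem_translate_iff add.assoc add.left_commute)
      moreover have "sym_diff ((+) c ` S) T = (+) ?e ` S"
        unfolding T_def by (rule Set.set_eqI) (simp only: Un_iff Diff_iff, meson)
      ultimately have eq: "tau ?e (gvec j (A \<inter> {i. i $ k = 1}) S) = eps T (tau c (gvec j A' S))"
        unfolding a(1) tau_gvec eps_gvec by simp
      have "eps T (tau c (gvec j A' S)) - gvec j A' S \<in> lat p (coord_space J)"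
        using eps_tau_in_lat[OF g coord_space_translate[OF c] T] by simp
      then have "- (eps T (tau c (gvec j A' S)) - gvec j A' S) \<in> lat p (coord_space J)"
        by (simp only: lat_uminus_iff)
      then show ?thesis
        using g unfolding eq A'_def[symmetric] by simp
    qed
  qed
  show d: "x0 - y \<in> lat p (coord_space J)"
    unfolding x0_def y_def
    by (rule lat_map[OF assms(1)]) (use main in \<open>simp_all add: restr_diff tau_diff restr_gvec\<close>)
  show z: "x0 \<in> lat (p - 1) (coord_space J)"
    unfolding x0_def
    by (rule lat_map[OF assms(1)]) (use main in \<open>simp_all add: restr_diff restr_gvec\<close>)
  have "x0 - (x0 - y) \<in> lat (p - 1) (coord_space J)"
    by (rule lat_diff[OF z lat_mono[OF d]]) simp_all
  then show "y \<in> lat (p - 1) (coord_space J)"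
    by simp
qed

section \<open>Shortest vectors\<close>

lemma eps_scaleR: "eps S (r *\<^sub>R x) = r *\<^sub>R eps S x"
  by (simp add: vec_eq_iff eps_nth)

lemma eps_add: "eps S (x + y) = eps S x + eps S y"
  by (simp add: vec_eq_iff eps_nth)

text \<open>Averaging \<open>y\<close> with \<open>eps H y\<close> cuts it down to a half space, so the sign changes from \<open>RM 1\<close>
  applied to \<open>y\<close> span all basis vectors in the support of \<open>y\<close>.\<close>

lemma exists_eps_inner_nonzero:
  fixes x y :: "('d::finite) bw_space"
  assumes "x $ i \<noteq> 0" "y $ i \<noteq> 0"
  obtains T where "T \<in> RM 1" "x \<bullet> eps T y \<noteq> 0"
proof (rule ccontr)
  assume "\<not> thesis"
  then have zero: "x \<bullet> eps T y = 0" if "T \<in> RM 1" for T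
    using that \<open>\<And>T. T \<in> RM 1 \<Longrightarrow> x \<bullet> eps T y \<noteq> 0 \<Longrightarrow> thesis\<close> by blast
  \<comment> \<open>As \<open>K\<close> grows, \<open>B K\<close> shrinks from the whole space to
    the point \<open>i\<close>, and orthogonality survives each halving.\<close>
  define B where "B K = {z. \<forall>k\<in>K. z $ k = i $ k}" for K :: "'d set"
  have "\<forall>T\<in>RM 1. x \<bullet> eps T (restr (B K) y) = 0" if "finite K" for K
    using that
  proof induction
    case empty
    have "restr (B {}) y = y"
      by (simp add: vec_eq_iff restr_nth B_def)
    then show ?case
      using zero by simp
  next
    case (insert k K)
    let ?H = "{z. z $ k = i $ k + 1}" and ?r = "restr (B K) y"
    have "z $ k = i $ k + 1 \<longleftrightarrow> z $ k \<noteq> i $ k" for z :: "'d omega"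
      by (cases "z $ k"; cases "i $ k") auto
    then have eq: "restr (B (insert k K)) y = (1 / 2) *\<^sub>R (?r + eps ?H ?r)"
      by (auto simp: vec_eq_iff restr_nth eps_nth B_def)
    show ?case
    proof
      fix T :: "'d omega set"
      assume T: "T \<in> RM 1"
      then have "sym_diff T ?H \<in> RM 1"
        using RM_coordinate by (rule RM_sym_diff)
      then show "x \<bullet> eps T (restr (B (insert k K)) y) = 0"
        unfolding eq eps_scaleR eps_add eps_eps using insert.IH T by (simp add: inner_add_right)
    qed
  qed
  then have "x \<bullet> eps {} (restr (B UNIV) y) = 0"
    using RM.empty by (metis finite_code)
  moreover have "restr (B UNIV) y = axis i (y $ i)"
  proof -
    have "B UNIV = {i}"
      by (auto simp: B_def vec_eq_iff)
    moreover have "restr {i} y $ l = axis i (y $ i) $ l" for l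
      by (cases "l = i") (simp_all add: restr_nth axis_def)
    ultimately show ?thesis
      by (metis vec_eq_iff)
  qed
  ultimately show False
    using assms by (simp add: inner_axis)
qed

text \<open>The orbit of \<open>a\<close> under \<open>R\<close> spans the space, and it lies in one class modulo the next level.
  A shortest vector of that class outside the orbit would be orthogonal to all of it.\<close>

lemma shortest_congruent:
  fixes a b :: "('d::finite) bw_space"
  assumes a: "a \<in> shortest p (coord_space J)" and b: "b \<in> shortest p (coord_space J)"
    and ab: "a - b \<in> lat (p + 1) (coord_space J)"
    and bound: "\<And>x. \<lbrakk>x \<in> lat (p + 1) (coord_space J); x \<noteq> 0\<rbrakk> \<Longrightarrow> 2 powi (p + 1) \<le> x \<bullet> x"
  obtains c T where "c \<in> coord_space J" "T \<in> RM 1" "b = eps T (tau c a)"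
proof -
  let ?U = "coord_space J"
  have nb: "b \<bullet> b = 2 powi p" and na: "a \<bullet> a = 2 powi p"
    using a b inner_shortest by blast+
  then have "b \<noteq> 0"
    by auto
  then obtain i where i: "b $ i \<noteq> 0"
    by (auto simp: vec_eq_iff)
  then have iU: "i \<in> ?U"
    using b unfolding shortest_def by (auto simp: gvec_nth split: if_splits)
  obtain j A S n where A: "a = gvec j A S" "affine_subspace n A" "A \<subseteq> ?U"
    using a unfolding shortest_def by blast
  obtain z where z: "z \<in> A"
    using affine_subspaceE[OF A(2)] .
  \<comment> \<open>Translation by \<open>c\<close> moves the point \<open>z\<close> of the support
    of \<open>a\<close> to the point \<open>i\<close> of the support of \<open>b\<close>.\<close>
  define c where "c = i + z"
  have c: "c \<in> ?U"
    unfolding c_def using iU z A(3) by (intro coord_space_add) auto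
  have "c + i = z"
    by (simp add: c_def add.assoc add.left_commute)
  then have "tau c a $ i \<noteq> 0"
    using z by (simp add: tau_nth A(1) gvec_nth)
  then obtain T where T: "T \<in> RM 1" and bt: "b \<bullet> eps T (tau c a) \<noteq> 0"
    using exists_eps_inner_nonzero[where x = b] i by blast
  define a' where "a' = eps T (tau c a)"
  have na': "a' \<bullet> a' = 2 powi p"
    by (simp add: a'_def inner_eps inner_tau na)
  have "a' - a \<in> lat (p + 1) ?U"
    unfolding a'_def using a shortest_subset_lat coord_space_translate[OF c] T
    by (intro eps_tau_in_lat) auto
  from lat_add[OF this ab] have diff: "a' - b \<in> lat (p + 1) ?U"
    by simp
  have "b \<in> lat p ?U"
    using b shortest_subset_lat by blast
  then have "2 *\<^sub>R b \<in> lat (p + 1) ?U"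
    by (rule lat_mono[OF double_in_lat]) simp_all
  from lat_add[OF diff this] have plus: "a' + b \<in> lat (p + 1) ?U"
    by (simp add: scaleR_2 add.commute)
  have e: "(2 :: real) powi (p + 1) = 2 * 2 powi p"
    by (simp add: power_int_add)
  have "a' = b \<or> a' = - b"
  proof (rule ccontr)
    assume "\<not> (a' = b \<or> a' = - b)"
    then have "a' - b \<noteq> 0" "a' + b \<noteq> 0"
      by (simp_all add: add_eq_0_iff2)
    \<comment> \<open>Both squares equal \<open>2 * 2 powi p\<close> up to twice the inner product
      of \<open>b\<close> and \<open>a'\<close>, taken with opposite signs, so the two bounds force
      it to vanish.\<close>
    then have "2 powi (p + 1) \<le> (a' - b) \<bullet> (a' - b)" "2 powi (p + 1) \<le> (a' + b) \<bullet> (a' + b)"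
      using bound diff plus by blast+
    then have "b \<bullet> a' = 0"
      unfolding e by (simp add: inner_diff inner_add na' nb inner_commute)
    then show False
      using bt unfolding a'_def by simp
  qed
  then show thesis
  proof
    assume "a' = b"
    with c T that show thesis
      unfolding a'_def by blast
  next
    assume "a' = - b"
    \<comment> \<open>The sign -1 is the sign change over the whole space, which belongs to
      \<open>RM 1\<close>.\<close>
    then have "b = eps (sym_diff UNIV T) (tau c a)"
      unfolding eps_eps[symmetric] by (simp add: a'_def)
    moreover have "sym_diff UNIV T \<in> RM 1"
      using RM_UNIV T by (rule RM_sym_diff)
    ultimately show thesis
      using c that by blast
  qed
qed

section \<open>The base case of a single point\<close>

lemma coord_space_empty: "coord_space {} = {0}"
  by (auto simp: coord_space_def vec_eq_iff)

text \<open>A nonzero generator over a point has dimension 0, so \<open>p \<le> 2 * j\<close>; the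
  least such \<open>j\<close> is half of \<open>p\<close> rounded up, that is
  \<open>(p + 1) div 2\<close>.\<close>

lemma lat_point:
  fixes x :: "('d::finite) bw_space"
  assumes "x \<in> lat p {0}"
  obtains z :: int where "x = (of_int z * 2 powi ((p + 1) div 2)) *\<^sub>R axis 0 1"
proof -
  let ?q = "(p + 1) div 2"
  have "\<exists>z :: int. x = (of_int z * 2 powi ?q) *\<^sub>R axis 0 1"
    using assms unfolding lat_def
  proof induction
    case (base s)
    show ?case
    proof (cases "s = 0")
      case True
      then show ?thesis
        by (intro exI[of _ 0]) simp
    next
      case False
      then obtain j A S n where s: "s = gvec j A S" "affine_subspace n A" "A \<subseteq> {0}" "p \<le> 2 * j + int n"
        using base unfolding gens_def by blast
      obtain y where "y \<in> A"
        using affine_subspaceE[OF s(2)] .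
      with s(3) have A: "A = {0}"
        by blast
      then have "n = 0"
        using affine_subspace_dim_unique[OF s(2)] affine_subspace_0_singleton by metis
      then have "?q \<le> j"
        using s(4) by linarith
      then have pow: "2 powi j = of_int (2 ^ nat (j - ?q)) * (2 powi ?q :: real)"
        by (simp add: power_int_add[symmetric] flip: power_int_of_nat)
      have "s = (of_int (if 0 \<in> S then - (2 ^ nat (j - ?q)) else 2 ^ nat (j - ?q)) * 2 powi ?q) *\<^sub>R axis 0 1"
        (is "s = ?t")
      proof -
        have "s $ i = ?t $ i" for i
          by (cases "i = 0") (use pow in \<open>simp_all add: s(1) A gvec_nth axis_def\<close>)
        then show ?thesis
          by (metis vec_eq_iff)
      qed
      then show ?thesis
        by blast
    qed
  next
    case (diff s t)
    then obtain u v :: int where "s = (of_int u * 2 powi ?q) *\<^sub>R axis 0 1" "t = (of_int v * 2 powi ?q) *\<^sub>R axis 0 1"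
      by blast
    then show ?case
      by (intro exI[of _ "u - v"]) (simp add: algebra_simps)
  qed
  then show thesis
    using that by blast
qed

text \<open>The squared length is the square of a nonzero integer times an even power of 2 that is
  at least \<open>2 powi p\<close>. Equality forces \<open>p\<close> to be even and the integer to
  be 1 or -1.\<close>

lemma lat_min_point:
  fixes x :: "('d::finite) bw_space"
  assumes x: "x \<in> lat p {0}" and "x \<noteq> 0"
  shows "2 powi p \<le> x \<bullet> x" and "x \<bullet> x = 2 powi p \<Longrightarrow> x \<in> shortest p {0}"
proof -
  let ?q = "(p + 1) div 2"
  obtain z :: int where z: "x = (of_int z * 2 powi ?q) *\<^sub>R axis 0 1"
    using lat_point[OF x] .
  have xx: "x \<bullet> x = (of_int z)\<^sup>2 * 2 powi (2 * ?q)"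
    unfolding z by (simp add: inner_axis power2_eq_square power_int_mult power_int_mult_distrib[symmetric])
  have "z \<noteq> 0"
    using assms(2) z by auto
  then have z2: "1 \<le> z\<^sup>2"
    by (simp add: int_one_le_iff_zero_less)
  then have z1: "1 \<le> (of_int z :: real)\<^sup>2"
    by (metis of_int_1_le_iff of_int_power)
  have q: "(2 :: real) powi p \<le> 2 powi (2 * ?q)"
    by (rule power_int_increasing) auto
  have qx: "2 powi (2 * ?q) \<le> x \<bullet> x"
    unfolding xx using mult_right_mono[OF z1, of "2 powi (2 * ?q)"] by simp
  with q show "2 powi p \<le> x \<bullet> x"
    by linarith
  assume eq: "x \<bullet> x = 2 powi p"
  then have "(2 :: real) powi p = 2 powi (2 * ?q)"
    using q qx by linarith
  then have "\<not> p < 2 * ?q"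
    using power_int_strict_increasing[of p "2 * ?q" "2 :: real"] by linarith
  then have p: "p = 2 * ?q"
    by linarith
  then have "(of_int z :: real)\<^sup>2 = 1"
    using eq unfolding xx by simp
  then have z3: "(of_int z :: real) = 1 \<or> (of_int z :: real) = -1"
    by (simp only: power2_eq_1_iff)
  have "x = gvec ?q {0} (if (of_int z :: real) = 1 then {} else UNIV)"
    (is "x = ?t")
  proof -
    have "x $ i = ?t $ i" for i
      using z3 by (cases "i = 0") (auto simp: z gvec_nth axis_def)
    then show ?thesis
      by (metis vec_eq_iff)
  qed
  moreover have "(if (of_int z :: real) = 1 then {} else UNIV) \<in> RM 2"
    by (simp add: RM.empty RM_UNIV)
  ultimately show "x \<in> shortest p {0}"
    unfolding shortest_def using p affine_subspace_0_singleton by (smt (verit) mem_Collect_eq of_nat_0 order_refl)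
qed

section \<open>Gluing two halves, and the induction\<close>

lemma shortest_mono: "U \<subseteq> V \<Longrightarrow> shortest p U \<subseteq> shortest p V"
  unfolding shortest_def by blast

lemma tau_shortest:
  assumes "x \<in> shortest p U" "(+) c ` U \<subseteq> V"
  shows "tau c x \<in> shortest p V"
proof -
  obtain j A S n where x: "x = gvec j A S" "affine_subspace n A" "A \<subseteq> U" "S \<in> RM 2" "2 * j + int n = p"
    using assms(1) unfolding shortest_def by blast
  have "(+) c ` A \<subseteq> V"
    using x(3) assms(2) by blast
  then show ?thesis
    unfolding x(1) tau_gvec shortest_def
    using affine_subspace_translate[OF x(2)] RM_translate[OF x(4)] x(5) by blast
qed

text \<open>The sign change needed on the half \<open>x $ k = 1\<close> lies in \<open>RM 1\<close>; cut down to this half it lies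
  in \<open>RM 2\<close>, so a single sign set serves both halves.\<close>

lemma shortest_glue:
  assumes r: "r \<in> shortest (p - 1) (coord_space J)" and c: "c \<in> coord_space J" and T: "T \<in> RM 1"
    and k: "k \<notin> J"
  shows "r + tau (axis k 1) (eps T (tau c r)) \<in> shortest p (coord_space (insert k J))"
proof -
  let ?e = "axis k 1" and ?H = "{x. x $ k = 1}" and ?U = "coord_space (insert k J)"
  obtain j A S n where x: "r = gvec j A S" "affine_subspace n A" "A \<subseteq> coord_space J" "S \<in> RM 2"
      "2 * j + int n = p - 1"
    using r unfolding shortest_def by blast
  define a where "a = ?e + c"
  define S1 where "S1 = (+) ?e ` (sym_diff ((+) c ` S) T)"
  have "(+) ?e ` (+) c ` A = (+) a ` A"
    unfolding a_def by (rule Set.set_eqI) (simp only: mem_translate_iff add.assoc add.left_commute)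
  then have r1: "tau ?e (eps T (tau c r)) = gvec j ((+) a ` A) S1"
    unfolding x(1) tau_gvec eps_gvec S1_def by simp
  \<comment> \<open>\<open>S1\<close> differs from \<open>S\<close> by the derivative of
    \<open>S\<close> in direction \<open>a\<close> and a translate of \<open>T\<close>, so the
    difference has degree at most 1.\<close>
  have SS1: "sym_diff S S1 = sym_diff (sym_diff S ((+) a ` S)) ((+) ?e ` T)"
  proof -
    have "(+) ?e ` (+) c ` S = (+) a ` S"
      unfolding a_def by (rule Set.set_eqI) (simp only: mem_translate_iff add.assoc add.left_commute)
    then have "S1 = sym_diff ((+) a ` S) ((+) ?e ` T)"
      unfolding S1_def sym_diff_translate by simp
    then show ?thesis
      by blast
  qed
  have "sym_diff S S1 \<in> RM 1"
    unfolding SS1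
    by (intro RM_sym_diff RM_sym_diff_translate[of S 1, unfolded one_add_one, OF x(4)] RM_translate T)
  moreover obtain m where "affine_subspace m ?H" "CARD('a) \<le> m + 1"
    using affine_subspace_coordinate .
  ultimately have "sym_diff S S1 \<inter> ?H \<in> RM 2"
    using RM_Int[of "sym_diff S S1" 1, unfolded one_add_one] by blast
  \<comment> \<open>This set agrees with \<open>S\<close> off \<open>?H\<close> and with
    \<open>S1\<close> on \<open>?H\<close>, the sides that hold the two supports.\<close>
  then have S': "sym_diff S (sym_diff S S1 \<inter> ?H) \<in> RM 2" (is "?S' \<in> _")
    using x(4) by (intro RM_sym_diff)
  have low: "y $ k = 0" if "y \<in> coord_space J" for y
    using that k by (simp add: coord_space_def)
  have ak: "a $ k = 1"
    using low[OF c] by (simp add: a_def axis_def)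
  have AH: "A \<inter> ?H = {}"
    using low x(3) by fastforce
  have aAH: "(+) a ` A \<subseteq> ?H"
    using low x(3) ak by fastforce
  then have disj: "A \<inter> (+) a ` A = {}"
    using AH by blast
  have "A \<inter> S = A \<inter> ?S'"
    using AH by blast
  then have g0: "gvec j A S = gvec j A ?S'"
    by (rule gvec_cong)
  have "B \<inter> S1 = B \<inter> ?S'" if "B \<subseteq> ?H" for B
    using that by blast
  then have g1: "gvec j ((+) a ` A) S1 = gvec j ((+) a ` A) ?S'"
    using aAH by (intro gvec_cong)
  have "r + tau ?e (eps T (tau c r)) = gvec j A ?S' + gvec j ((+) a ` A) ?S'"
    using arg_cong2[where f = "(+)", OF g0 g1] unfolding r1 by (simp only: x(1))
  also have "\<dots> = gvec j (A \<union> (+) a ` A) ?S'"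
    by (rule gvec_Un[OF disj, symmetric])
  finally have eq: "r + tau ?e (eps T (tau c r)) = gvec j (A \<union> (+) a ` A) ?S'" .
  have mono: "coord_space J \<subseteq> ?U"
    by (auto simp: coord_space_def)
  moreover have "?e \<in> ?U"
    by (simp add: coord_space_def axis_def)
  ultimately have "a \<in> ?U"
    unfolding a_def using c by (intro coord_space_add) auto
  then have "(+) a ` A \<subseteq> ?U"
    using x(3) mono coord_space_add by fastforce
  then have "A \<union> (+) a ` A \<subseteq> ?U"
    using x(3) mono by blast
  moreover have "2 * j + int (n + 1) = p"
    using x(5) by simp
  ultimately show ?thesis
    unfolding eq shortest_def using affine_subspace_Un_translate[OF x(2) disj] S' by blast
qed

text \<open>Induction on \<open>J\<close> with the level kept arbitrary, since the halves are used
  both at level \<open>p - 1\<close> and at level \<open>p\<close>. Two nonzero halves contribute at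
  least \<open>2 powi (p - 1)\<close> each, so equality makes both of them shortest.\<close>

lemma lat_min:
  fixes x :: "('d::finite) bw_space"
  assumes "x \<in> lat p (coord_space J)" "x \<noteq> 0"
  shows "2 powi p \<le> x \<bullet> x \<and> (x \<bullet> x = 2 powi p \<longrightarrow> x \<in> shortest p (coord_space J))"
proof -
  have "finite J"
    by simp
  then show ?thesis
    using assms
  proof (induction arbitrary: p x)
    case empty
    then show ?case
      unfolding coord_space_empty using lat_min_point by blast
  next
    case (insert k J)
    let ?e = "axis k 1 :: 'd omega"
    define r0 where "r0 = restr {i. i $ k = 0} x"
    define r1 where "r1 = restr {i. i $ k = 1} x"
    define y where "y = tau ?e r1"
    note mem = restr_in_lat[OF insert.prems(1) insert.hyps(2), folded r0_def r1_def, folded y_def]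
    have x: "x = r0 + r1"
      by (auto simp: vec_eq_iff r0_def r1_def restr_nth)
    have "r0 \<bullet> r1 = 0"
      unfolding inner_vec_def by (rule sum.neutral) (auto simp: r0_def r1_def restr_nth)
    then have xx: "x \<bullet> x = r0 \<bullet> r0 + y \<bullet> y"
      unfolding x y_def inner_tau by (simp add: inner_add inner_commute)
    have r1: "r1 = tau ?e y"
      by (simp add: y_def)
    have mono: "coord_space J \<subseteq> coord_space (insert k J)"
      by (auto simp: coord_space_def)
    have shift: "(+) ?e ` coord_space J \<subseteq> coord_space (insert k J)"
      by (auto simp: coord_space_def axis_def)
    consider "r1 = 0" | "r0 = 0" | "r0 \<noteq> 0" "r1 \<noteq> 0"
      by blast
    then show ?case
    proof cases
      case 1
      then have "y = 0" "x = r0"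
        by (simp_all add: y_def x)
      \<comment> \<open>With one half zero, the congruence of the halves puts the other at level
        \<open>p\<close> rather than \<open>p - 1\<close>, so the full bound holds.\<close>
      then have "x \<in> lat p (coord_space J)"
        using mem(1) by simp
      from insert.IH[OF this insert.prems(2)] show ?thesis
        using shortest_mono[OF mono] by blast
    next
      case 2
      then have "- y \<in> lat p (coord_space J)"
        using mem(1) by simp
      then have "y \<in> lat p (coord_space J)"
        by (simp only: lat_uminus_iff)
      moreover have "y \<noteq> 0"
        using 2 insert.prems(2) r1 x by auto
      ultimately have "2 powi p \<le> y \<bullet> y \<and> (y \<bullet> y = 2 powi p \<longrightarrow> y \<in> shortest p (coord_space J))"
        by (rule insert.IH)
      moreover have "x = tau ?e y" "x \<bullet> x = y \<bullet> y"
        using 2 x r1 xx by simp_all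
      ultimately show ?thesis
        using tau_shortest[OF _ shift] by auto
    next
      case 3
      then have "y \<noteq> 0"
        using r1 by auto
      have e: "(2 :: real) powi p = 2 powi (p - 1) + 2 powi (p - 1)"
        by (simp add: power_int_diff)
      have b0: "2 powi (p - 1) \<le> r0 \<bullet> r0" "r0 \<bullet> r0 = 2 powi (p - 1) \<Longrightarrow> r0 \<in> shortest (p - 1) (coord_space J)"
        using insert.IH[OF mem(2) 3(1)] by blast+
      have b1: "2 powi (p - 1) \<le> y \<bullet> y" "y \<bullet> y = 2 powi (p - 1) \<Longrightarrow> y \<in> shortest (p - 1) (coord_space J)"
        using insert.IH[OF mem(3) \<open>y \<noteq> 0\<close>] by blast+
      have "x \<in> shortest p (coord_space (insert k J))" if "x \<bullet> x = 2 powi p"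
      proof -
        have r0: "r0 \<in> shortest (p - 1) (coord_space J)"
          using that b0 b1 unfolding xx e by linarith
        moreover have "y \<in> shortest (p - 1) (coord_space J)"
          using that b0 b1 unfolding xx e by linarith
        moreover have "r0 - y \<in> lat (p - 1 + 1) (coord_space J)"
          using mem(1) by simp
        \<comment> \<open>The induction hypothesis at level \<open>p\<close>, written
          \<open>p - 1 + 1\<close>, supplies the length bound required of differences.\<close>
        ultimately obtain c T where "c \<in> coord_space J" "T \<in> RM 1" "y = eps T (tau c r0)"
          by (rule shortest_congruent) (use insert.IH in auto)
        then show ?thesis
          using shortest_glue[OF r0 _ _ insert.hyps(2)] x r1 by metis
      qed
      then show ?thesis
        using b0(1) b1(1) unfolding xx e by auto
    qed
  qed
qed

section \<open>The Barnes-Wall lattice and its twist\<close>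

lemma coord_space_UNIV: "coord_space UNIV = UNIV"
  by (simp add: coord_space_def)

text \<open>The scaling factor of the form is positive, so it drops out of the comparison of
  lengths.\<close>

lemma mem_minimal_vectors:
  "x \<in> minimal_vectors L \<longleftrightarrow> x \<in> L \<and> x \<noteq> 0 \<and> (\<forall>y\<in>L. y \<noteq> 0 \<longrightarrow> x \<bullet> x \<le> y \<bullet> y)"
  by (simp add: minimal_vectors_def bw_form_def)

text \<open>A single shortest vector shows that the lower bound of \<open>lat_min\<close> is
  attained, which pins every minimal vector to this length.\<close>

lemma minimal_vectors_lat:
  assumes "shortest p UNIV \<noteq> ({} :: ('d::finite) bw_space set)"
  shows "minimal_vectors (lat p UNIV) = (shortest p UNIV :: 'd bw_space set)"
proof -
  note min = lat_min[where J = UNIV, unfolded coord_space_UNIV]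
  obtain s :: "'d bw_space" where s: "s \<in> shortest p UNIV"
    using assms by blast
  have "x \<in> minimal_vectors (lat p UNIV) \<longleftrightarrow> x \<in> shortest p UNIV" for x :: "'d bw_space"
  proof
    assume "x \<in> minimal_vectors (lat p UNIV)"
    then have x: "x \<in> lat p UNIV" "x \<noteq> 0"
      and le: "\<And>y :: 'd bw_space. \<lbrakk>y \<in> lat p UNIV; y \<noteq> 0\<rbrakk> \<Longrightarrow> x \<bullet> x \<le> y \<bullet> y"
      unfolding mem_minimal_vectors by blast+
    have "s \<in> lat p UNIV" "s \<bullet> s = 2 powi p"
      using s shortest_subset_lat inner_shortest by blast+
    moreover from this have "s \<noteq> 0"
      by auto
    ultimately have "x \<bullet> x = 2 powi p"
      using min[OF x] le[of s] by auto
    then show "x \<in> shortest p UNIV"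
      using min[OF x] by blast
  next
    assume x: "x \<in> shortest p UNIV"
    then have "x \<in> lat p UNIV" "x \<bullet> x = 2 powi p"
      using shortest_subset_lat inner_shortest by blast+
    moreover from this have "x \<noteq> 0"
      by auto
    ultimately show "x \<in> minimal_vectors (lat p UNIV)"
      unfolding mem_minimal_vectors using min by auto
  qed
  then show ?thesis
    by blast
qed

lemma scaled_eps_v_set: "(1 / 2 ^ m) *\<^sub>R eps S (v_set A) = gvec (- int m) A S"
  by (simp add: gvec_def power_int_minus divide_inverse)

text \<open>In dimension \<open>2 * m\<close> level 0 means \<open>- int m \<le> j\<close>, so a
  defining generator is doubled repeatedly. In dimension \<open>2 * m + 1\<close> parity gives the
  same bound on \<open>j\<close>, and the two halves of the subspace have dimension
  \<open>2 * m\<close>.\<close>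

lemma BW_eq_lat: "BW = (lat 0 UNIV :: ('d::finite) bw_space set)"
proof -
  let ?G = "{gvec (- int m) A S |m A S. affine_subspace (2 * m) A \<and> S \<in> RM 2} :: 'd bw_space set"
  have even: "gvec j A S \<in> group_closure ?G"
    if "affine_subspace (2 * m) A" "S \<in> RM 2" "- int m \<le> j" for j m and A S :: "'d omega set"
  proof -
    have "gvec (- int m + int i) A S \<in> group_closure ?G" for i
    proof (induction i)
      case 0
      show ?case
        by (rule group_closure.base) (use that in auto)
    next
      case (Suc i)
      have "gvec (- int m + int (Suc i)) A S = 2 *\<^sub>R gvec (- int m + int i) A S"
        unfolding double_gvec by (simp add: add.commute add.left_commute)
      then show ?case
        using group_closure_add[OF Suc Suc] by (simp add: scaleR_2)
    qed
    from this[of "nat (j + int m)"] show ?thesis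
      using that(3) by simp
  qed
  have "gvec j A S \<in> group_closure ?G"
    if *: "affine_subspace n A" "S \<in> RM 2" "0 \<le> 2 * j + int n" for j n and A S :: "'d omega set"
  proof (cases "even n")
    case True
    then show ?thesis
      using even[of "n div 2"] * by auto
  next
    case False
    then obtain m where m: "n = 2 * m + 1"
      by (rule oddE)
    \<comment> \<open>Two distinct points of \<open>A\<close> differ in some coordinate
      \<open>k\<close>, whose hyperplane cuts \<open>A\<close> into two halves.\<close>
    have "card A \<noteq> 1"
      unfolding card_affine_subspace[OF *(1)] m by simp
    then obtain u v where uv: "u \<in> A" "v \<in> A" "u \<noteq> v"
      using affine_subspaceE[OF *(1)] by (metis is_singletonI' is_singleton_altdef empty_iff)
    then obtain k where "u $ k \<noteq> v $ k"
      by (auto simp: vec_eq_iff)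
    then have "u $ k = 0 \<and> v $ k = 1 \<or> v $ k = 0 \<and> u $ k = 1"
      by (cases "u $ k"; cases "v $ k") simp_all
    then obtain q r where qr: "q \<in> A" "r \<in> A" "q $ k = 0" "r $ k = 1"
      using uv(1,2) by blast
    define A0 where "A0 = A \<inter> {x. x $ k = 0}"
    obtain n' a where n': "affine_subspace n' A0" "n = n' + 1" "A0 \<inter> (+) a ` A0 = {}" "A = A0 \<union> (+) a ` A0"
      by (rule affine_subspace_split[OF *(1) qr, folded A0_def]) (rule that)
    have "n' = 2 * m"
      using n'(2) m by simp
    then have A0: "affine_subspace (2 * m) A0" "affine_subspace (2 * m) ((+) a ` A0)"
      using n'(1) affine_subspace_translate by auto
    have "- int m \<le> j"
      using *(3) m by linarith
    then have "gvec j A0 S + gvec j ((+) a ` A0) S \<in> group_closure ?G"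
      using even A0 *(2) by (intro group_closure_add) blast+
    then show ?thesis
      using gvec_Un[OF n'(3)] n'(4) by metis
  qed
  then have gens: "gens 0 UNIV \<subseteq> group_closure ?G"
    unfolding gens_def by auto
  have "x \<in> group_closure ?G" if "x \<in> lat 0 UNIV" for x
    by (rule group_closure_map[where g = "\<lambda>x. x", OF that[unfolded lat_def]]) (use gens in auto)
  moreover have G: "x \<in> lat 0 UNIV" if "x \<in> ?G" for x
    using that gvec_in_lat[where p = 0 and U = UNIV] by force
  have "x \<in> lat 0 UNIV" if "x \<in> group_closure ?G" for x
    unfolding lat_def
    by (rule group_closure_map[where g = "\<lambda>x. x", OF that refl]) (rule G[unfolded lat_def])
  ultimately show ?thesis
    unfolding BW_def scaled_eps_v_set by blast
qed

text \<open>Acting trivially on all quotients of successive levels is preserved by composition, and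
  the generators are involutions, so inverses bring nothing new.\<close>

lemma R_group_in_lat:
  assumes "f \<in> R_group" "x \<in> lat p UNIV"
  shows "f x - x \<in> lat (p + 1) (UNIV :: ('d::finite) omega set)"
proof -
  let ?B = "BijGroup (UNIV :: 'd bw_space set)" and ?X = "eps ` RM 1 \<union> range tau :: ('d bw_space \<Rightarrow> 'd bw_space) set"
  interpret group ?B
    by (rule group_BijGroup)
  have Bij: "h \<in> carrier ?B \<longleftrightarrow> bij h" for h
    by (simp add: BijGroup_def Bij_def)
  have mult: "g \<otimes>\<^bsub>?B\<^esub> h = g \<circ> h" if "bij g" "bij h" for g h
    using that by (simp add: BijGroup_def Bij_def compose_def fun_eq_iff)
  have one_eq: "\<one>\<^bsub>?B\<^esub> = id"
    by (simp add: BijGroup_def fun_eq_iff)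
  have invol: "h \<circ> h = id" if "h \<in> ?X" for h
    using that by auto
  then have bij: "bij h" if "h \<in> ?X" for h
    using that o_bij by blast
  then have X: "?X \<subseteq> carrier ?B"
    using Bij by blast
  have inv_eq: "inv\<^bsub>?B\<^esub> h = h" if "h \<in> ?X" for h
    using bij[OF that] by (intro inv_equality) (simp_all add: mult one_eq invol[OF that] Bij)
  have gen: "h x - x \<in> lat (p + 1) UNIV" if "h \<in> ?X" "x \<in> lat p UNIV" for h p x
    using that eps_in_lat tau_in_lat[of x p UNIV] by (auto simp: surj_plus)
  have "f \<in> generate ?B ?X"
    using assms(1) by (simp add: R_group_def)
  \<comment> \<open>The vector is generalised because in a product the outer factor acts on
    \<open>h x\<close> instead of \<open>x\<close>.\<close>
  then have "\<forall>p. \<forall>x\<in>lat p UNIV. f x - x \<in> lat (p + 1) UNIV"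
  proof induction
    case (eng g h)
    have "bij g" "bij h"
      using generate_in_carrier[OF X] eng(1,2) Bij by blast+
    then have gh: "g \<otimes>\<^bsub>?B\<^esub> h = g \<circ> h"
      by (rule mult)
    show ?case
      unfolding gh
    proof (intro allI ballI)
      fix p and x :: "'d bw_space"
      assume x: "x \<in> lat p UNIV"
      then have h: "h x - x \<in> lat (p + 1) UNIV"
        using eng by blast
      then have "h x \<in> lat p UNIV"
        using lat_add[OF lat_mono[OF h, of p UNIV] x] by simp
      then have "g (h x) - h x \<in> lat (p + 1) UNIV"
        using eng by blast
      from lat_add[OF this h] show "(g \<circ> h) x - x \<in> lat (p + 1) UNIV"
        by simp
    qed
  next
    case one
    show ?case
      by (simp add: one_eq)
  next
    case (incl h)
    then show ?case
      using gen by blast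
  next
    case (inv h)
    then show ?case
      using gen unfolding inv_eq[OF inv] by blast
  qed
  then show ?thesis
    using assms(2) by blast
qed

text \<open>Surjectivity uses that \<open>(f - 1) (- f - 1) = 2\<close> for a fourvolution \<open>f\<close>.\<close>

lemma twist_BW:
  assumes "f \<in> R_group" "fourvolution f"
  shows "twist f BW = lat 1 UNIV"
  unfolding twist_def BW_eq_lat
proof (intro equalityI subsetI)
  fix x
  assume "x \<in> (\<lambda>x. f x - x) ` lat 0 UNIV"
  then show "x \<in> lat 1 UNIV"
    using R_group_in_lat[OF assms(1), of _ 0] by auto
next
  fix x :: "'a bw_space"
  assume x: "x \<in> lat 1 UNIV"
  have f: "linear f" "f (f x) = - x"
    using assms(2) by (auto simp: fourvolution_def bw_isometry_def)
  \<comment> \<open>The preimage of \<open>x\<close> will be the negative of half of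
    \<open>f x + x\<close>. The latter is \<open>f x - x\<close> plus twice \<open>x\<close>, hence
    of level 2, so that halving it lands in level 0.\<close>
  have "f x - x \<in> lat (0 + 2) UNIV"
    using R_group_in_lat[OF assms(1) x] by simp
  moreover have "2 *\<^sub>R x \<in> lat (0 + 2) UNIV"
    by (rule lat_mono[OF double_in_lat[OF x]]) simp_all
  ultimately have "f x - x + 2 *\<^sub>R x \<in> lat (0 + 2) UNIV"
    by (rule lat_add)
  then have "(1 / 2) *\<^sub>R (f x - x + 2 *\<^sub>R x) \<in> lat 0 UNIV"
    by (rule half_in_lat)
  moreover have "f x - x + 2 *\<^sub>R x = f x + x"
    by (simp add: scaleR_2)
  ultimately have z: "- ((1 / 2) *\<^sub>R (f x + x)) \<in> lat 0 UNIV" (is "?z \<in> _")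
    by (simp only: lat_uminus_iff)
  have "f ?z = - ((1 / 2) *\<^sub>R (f x - x))"
    using f by (simp add: linear_neg linear_cmul linear_add linear_diff algebra_simps)
  then have "f ?z - ?z = (1 / 2) *\<^sub>R (x + x)"
    by (simp add: algebra_simps)
  then have "x = f ?z - ?z"
    by (simp add: scaleR_2[symmetric])
  with z show "x \<in> (\<lambda>x. f x - x) ` lat 0 UNIV"
    by (rule rev_image_eqI)
qed

theorem theorem10p1:
  fixes f :: "('d::finite) bw_space \<Rightarrow> 'd bw_space"
  assumes "CARD('d) \<ge> 2"
    and "f \<in> R_group"
    and "fourvolution f"
  shows "minimal_vectors (twist f BW) =
    {(1 / 2 ^ m) *\<^sub>R eps S (v_set A) |m A S. affine_subspace (2 * m + 1) A \<and> S \<in> RM 2}"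
proof -
  let ?R = "{gvec (- int m) A S |m A S. affine_subspace (2 * m + 1) A \<and> S \<in> RM 2} :: 'd bw_space set"
  have "shortest 1 UNIV \<subseteq> ?R"
  proof
    fix x :: "'d bw_space"
    assume "x \<in> shortest 1 UNIV"
    then obtain j A S n where x: "x = gvec j A S" "affine_subspace n A" "S \<in> RM 2" "2 * j + int n = 1"
      unfolding shortest_def by blast
    \<comment> \<open>The equation for \<open>j\<close> and \<open>n\<close> forces \<open>n\<close>
      to be odd and \<open>j\<close> to be at most 0, so \<open>nat\<close> loses nothing.\<close>
    define m where "m = nat (- j)"
    have "j = - int m" "n = 2 * m + 1"
      using x(4) unfolding m_def by linarith+
    with x(2,3) show "x \<in> ?R"
      unfolding x(1) by blast
  qed
  moreover have "?R \<subseteq> shortest 1 UNIV"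
    unfolding shortest_def by fastforce
  ultimately have R: "shortest 1 UNIV = ?R"
    by blast
  \<comment> \<open>The line through 0 and \<open>e\<close> with scale 1 provides one shortest
    vector of level 1.\<close>
  define e :: "'d omega" where "e = axis undefined 1"
  have "{0} \<inter> (+) e ` {0} = {}"
    by (simp add: e_def axis_eq_0_iff)
  from affine_subspace_Un_translate[OF affine_subspace_0_singleton this]
  have "gvec 0 ({0} \<union> (+) e ` {0}) {} \<in> shortest 1 UNIV"
    unfolding shortest_def using RM.empty by fastforce
  then have "minimal_vectors (lat 1 UNIV) = (shortest 1 UNIV :: 'd bw_space set)"
    by (intro minimal_vectors_lat) blast
  then show ?thesis
    unfolding twist_BW[OF assms(2,3)] scaled_eps_v_set R .
qed

end
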